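(* $T_2(7)=13$; that is, every triangle-free graph on $13$ vertices contains a $2$-sparse set of $7$ vertices, and there is a triangle-free graph on $12$ vertices containing no $2$-sparse set of $7$ vertices.
   Context: All graphs are finite and simple. A set $S$ of vertices of a graph $G$ is $k$-sparse if the induced subgraph $G[S]$ has maximum degree at most $k$. For integers $k\ge0$ and $j\ge1$, $T_k(j)$ denotes the minimum $n$ such that every triangle-free graph on $n$ vertices contains a $k$-sparse set of $j$ vertices. *)

theory Defs
  imports
    "Graph_Theory.Digraph"
    "Graph_Theory.Digraph_Component"
    "Graph_Theory.Pair_Digraph"
begin

text \<open>
  A finite simple graph is a \<^locale>\<open>pair_graph\<close>: a finite symmetric irreflexive set of arcs,
  each undirected edge being the two opposite arcs. Hence the degree of a vertex is its
  out-degree.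
\<close>

definition triangle_free :: "('a, 'b) pre_digraph \<Rightarrow> bool" where
  "triangle_free G \<longleftrightarrow>
     \<not> (\<exists>u v w. u \<rightarrow>\<^bsub>G\<^esub> v \<and> v \<rightarrow>\<^bsub>G\<^esub> w \<and> w \<rightarrow>\<^bsub>G\<^esub> u)"

definition sparse_set :: "nat \<Rightarrow> ('a, 'b) pre_digraph \<Rightarrow> 'a set \<Rightarrow> bool" where
  "sparse_set k G S \<longleftrightarrow>
     S \<subseteq> verts G \<and> (\<forall>v \<in> S. out_degree (G \<restriction> S) v \<le> k)"

text \<open>
  Every finite graph is isomorphic to one whose vertices are natural numbers, so the vertex
  type \<^typ>\<open>nat\<close> loses no generality. The minimum is a \<open>LEAST\<close>, which is
  unspecified where no suitable \<open>n\<close> exists.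
\<close>

definition T_sparse :: "nat \<Rightarrow> nat \<Rightarrow> nat" where
  "T_sparse k j = (LEAST n. \<forall>G :: nat pair_pre_digraph.
     pair_graph G \<and> triangle_free (with_proj G) \<and> card (pverts G) = n \<longrightarrow>
     (\<exists>S. sparse_set k (with_proj G) S \<and> card S = j))"

end

theory Submission
  imports Defs
begin

text \<open>
  Let \<open>G\<close> be triangle-free on 13 vertices. If all degrees are at most 5, then in a maximum
  cut every vertex has at most 2 neighbours on its own side, and one side has at least
  7 vertices. Otherwise some neighbourhood contains an independent 6-set \<open>A\<close>. If neither
  \<open>A \<union> {w}\<close> for some \<open>w \<notin> A\<close> nor the 7-set \<open>V - A\<close> is 2-sparse, then every vertex
  outside \<open>A\<close> has 3 neighbours in \<open>A\<close>, and some \<open>b\<close> outside \<open>A\<close> has two neighbours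
  \<open>c\<close>, \<open>d\<close> outside \<open>A\<close>. Now 3 neighbours of \<open>b\<close> in \<open>A\<close>, 2 neighbours of \<open>c\<close> in \<open>A\<close>,
  and \<open>c\<close>, \<open>d\<close> form a 2-sparse set: the only possible edges join \<open>{c, d}\<close> to the
  neighbours of \<open>c\<close>. For the lower bound take a complete bipartite graph with parts of
  size at most 6, realised on \<open>{..<n}\<close> by joining numbers of different parity.
\<close>

section \<open>Degrees within the sides of a maximum cut\<close>

lemma card_arcs_insert:
  assumes "finite X" "sym E" "irrefl E" "v \<notin> X"
  shows "card (E \<inter> insert v X \<times> insert v X) = card (E \<inter> X \<times> X) + 2 * card (E `` {v} \<inter> X)"
proof -
  let ?N = "E `` {v} \<inter> X"
  \<comment> \<open>Each neighbour \<open>w\<close> of \<open>v\<close> in \<open>X\<close>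
    contributes both \<open>(v, w)\<close> and \<open>(w, v)\<close>, hence the factor 2;
    irreflexivity excludes \<open>(v, v)\<close>.\<close>
  have eq: "E \<inter> insert v X \<times> insert v X = (E \<inter> X \<times> X) \<union> (Pair v ` ?N \<union> (\<lambda>w. (w, v)) ` ?N)"
    using assms(2,3) by (auto simp: irrefl_def dest: symD)
  have "card (Pair v ` ?N \<union> (\<lambda>w. (w, v)) ` ?N) = card (Pair v ` ?N) + card ((\<lambda>w. (w, v)) ` ?N)"
    using assms by (intro card_Un_disjoint) auto
  also have "\<dots> = 2 * card ?N"
    by (simp add: card_image inj_on_def)
  finally have N: "card (Pair v ` ?N \<union> (\<lambda>w. (w, v)) ` ?N) = 2 * card ?N" .
  show ?thesis
    unfolding eq N[symmetric] using assms by (intro card_Un_disjoint) auto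
qed

text \<open>A maximum cut is a split with the fewest arcs inside its two sides. A vertex with more
  neighbours on its own side than on the other could be moved across to lower that number.\<close>

lemma max_cut_half_degree:
  assumes "finite V" "sym E" "irrefl E"
  obtains X where "X \<subseteq> V"
    "\<And>v. v \<in> X \<Longrightarrow> 2 * card (E `` {v} \<inter> X) \<le> card (E `` {v} \<inter> V)"
    "\<And>v. v \<in> V - X \<Longrightarrow> 2 * card (E `` {v} \<inter> (V - X)) \<le> card (E `` {v} \<inter> V)"
proof -
  define m where "m X = card (E \<inter> X \<times> X)" for X
  define X where "X = arg_min_on (\<lambda>X. m X + m (V - X)) (Pow V)"
  have X: "X \<subseteq> V"
    unfolding X_def using arg_min_if_finite(1)[of "Pow V"] assms(1) by auto
  have min: "m X + m (V - X) \<le> m Y + m (V - Y)" if "Y \<subseteq> V" for Y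
    unfolding X_def using that assms(1) by (intro arg_min_least) auto
  \<comment> \<open>Formulated for an arbitrary side \<open>Y\<close> so that it applies to
    \<open>X\<close> and to \<open>V - X\<close> alike; \<open>le\<close> says that moving
    \<open>v\<close> out of \<open>Y\<close> is no improvement.\<close>
  have half: "2 * card (E `` {v} \<inter> Y) \<le> card (E `` {v} \<inter> V)"
    if Y: "Y \<subseteq> V" "v \<in> Y" and le: "m Y + m (V - Y) \<le> m (Y - {v}) + m (insert v (V - Y))" for v Y
  proof -
    have "finite Y" using Y assms(1) finite_subset by blast
    have "m Y = m (Y - {v}) + 2 * card (E `` {v} \<inter> (Y - {v}))"
      unfolding m_def using card_arcs_insert[of "Y - {v}" E v] Y assms \<open>finite Y\<close>
      by (simp add: insert_absorb)
    moreover have "m (insert v (V - Y)) = m (V - Y) + 2 * card (E `` {v} \<inter> (V - Y))"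
      unfolding m_def using card_arcs_insert[of "V - Y" E v] Y assms by simp
    moreover have "E `` {v} \<inter> (Y - {v}) = E `` {v} \<inter> Y"
      using assms(3) by (auto simp: irrefl_def)
    moreover have "card (E `` {v} \<inter> V) = card (E `` {v} \<inter> Y) + card (E `` {v} \<inter> (V - Y))"
      using Y assms(1) \<open>finite Y\<close> by (subst card_Un_disjoint[symmetric]) (auto intro: arg_cong[where f = card])
    ultimately show ?thesis using le by simp
  qed
  show ?thesis
  proof
    show "X \<subseteq> V" by (fact X)
    fix v
    show "2 * card (E `` {v} \<inter> X) \<le> card (E `` {v} \<inter> V)" if "v \<in> X"
    proof (rule half[OF X that])
      have "V - (X - {v}) = insert v (V - X)" using X that by auto
      then show "m X + m (V - X) \<le> m (X - {v}) + m (insert v (V - X))"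
        using min[of "X - {v}"] X by auto
    qed
    show "2 * card (E `` {v} \<inter> (V - X)) \<le> card (E `` {v} \<inter> V)" if "v \<in> V - X"
    proof (rule half[OF _ that])
      have "V - (V - X) = X" "V - insert v X = V - X - {v}" using X by auto
      then show "m (V - X) + m (V - (V - X)) \<le> m (V - X - {v}) + m (insert v (V - (V - X)))"
        using min[of "insert v X"] X that by auto
    qed auto
  qed
qed

section \<open>Seven sparse vertices from an independent 6-set\<close>

lemma sparse_seven_subset_of_independent_six:
  assumes "finite V" "card V = 13" "irrefl E"
    and nbrs: "\<And>v x y. (v, x) \<in> E \<Longrightarrow> (v, y) \<in> E \<Longrightarrow> (x, y) \<notin> E"
    and A: "A \<subseteq> V" "card A = 6" "E \<inter> A \<times> A = {}"
  shows "\<exists>S\<subseteq>V. card S = 7 \<and> (\<forall>v\<in>S. card (E `` {v} \<inter> S) \<le> 2)"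
proof (rule ccontr)
  assume "\<not> ?thesis"
  then have no: "\<exists>v\<in>S. card (E `` {v} \<inter> S) > 2" if "S \<subseteq> V" "card S = 7" for S
    using that by (meson not_less)
  have fA: "finite A" using A assms(1) finite_subset by blast
  have ge3: "card (E `` {w} \<inter> A) \<ge> 3" if w: "w \<in> V" "w \<notin> A" for w
  proof -
    \<comment> \<open>The vertex \<open>v\<close> of degree at least 3 must be \<open>w\<close>
      itself: a vertex of the independent set \<open>A\<close> has at most the neighbour
      \<open>w\<close> in \<open>insert w A\<close>.\<close>
    obtain v where v: "v \<in> insert w A" "card (E `` {v} \<inter> insert w A) > 2"
      using no[of "insert w A"] w A fA by auto
    show ?thesis
    proof (cases "v = w")
      case True
      then have "E `` {v} \<inter> insert w A = E `` {w} \<inter> A"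
        using assms(3) by (auto simp: irrefl_def)
      with v show ?thesis by simp
    next
      case False
      then have "E `` {v} \<inter> insert w A \<subseteq> {w}" using v A by auto
      then have "card (E `` {v} \<inter> insert w A) \<le> 1"
        using card_mono[of "{w}"] by fastforce
      with v show ?thesis by simp
    qed
  qed
  have "card (V - A) = 7" using assms A fA by (simp add: card_Diff_subset)
  then obtain b where b: "b \<in> V - A" "card (E `` {b} \<inter> (V - A)) > 2"
    using no[of "V - A"] by auto
  \<comment> \<open>The sizes 3, 2, 2 of \<open>P\<close>, \<open>Q\<close>, \<open>D\<close> add up
    to 7. Both \<open>D\<close> and \<open>Q\<close> are cut down to two elements because they will
    bound the degrees.\<close>
  then obtain D where D: "D \<subseteq> E `` {b} \<inter> (V - A)" "card D = 2"
    by (meson less_imp_le obtain_subset_with_card_n)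
  then obtain c d where cd: "D = {c, d}" "c \<noteq> d" by (meson card_2_iff)
  obtain P where P: "P \<subseteq> E `` {b} \<inter> A" "card P = 3"
    using ge3[of b] b by (meson DiffD1 DiffD2 obtain_subset_with_card_n)
  have "card (E `` {c} \<inter> A) \<ge> 2" using ge3[of c] D cd by auto
  then obtain Q where Q: "Q \<subseteq> E `` {c} \<inter> A" "card Q = 2"
    by (meson obtain_subset_with_card_n)
  have fin: "finite P" "finite Q" "finite D" using P Q D by (auto intro: card_ge_0_finite)
  \<comment> \<open>A common element would form a triangle with the adjacent vertices
    \<open>b\<close> and \<open>c\<close>.\<close>
  have PQ: "P \<inter> Q = {}" using P(1) Q(1) D(1) cd(1) nbrs by blast
  have "(P \<union> Q) \<inter> D = {}" using P(1) Q(1) D(1) by blast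
  then have "card (P \<union> Q \<union> D) = card P + card Q + card D"
    using fin PQ by (simp add: card_Un_disjoint)
  then have "card (P \<union> Q \<union> D) = 7" using P Q D by simp
  moreover have "P \<union> Q \<union> D \<subseteq> V" using P(1) Q(1) D(1) A(1) by blast
  ultimately obtain v where v: "v \<in> P \<union> Q \<union> D" "card (E `` {v} \<inter> (P \<union> Q \<union> D)) > 2"
    using no by meson
  have AA: "(x, y) \<notin> E" if "x \<in> A" "y \<in> A" for x y using A that by auto
  have DD: "(x, y) \<notin> E" if "x \<in> D" "y \<in> D" for x y
    using D(1) that nbrs by blast
  have PD: "(x, y) \<notin> E" "(y, x) \<notin> E" if "x \<in> P" "y \<in> D" for x y
    using P(1) D(1) that nbrs by blast+
  \<comment> \<open>Vertices of \<open>P\<close> and \<open>Q\<close> lie in the independent set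
    \<open>A\<close>, so they can only see \<open>D\<close>. Since \<open>P\<close> and
    \<open>D\<close> consist of neighbours of \<open>b\<close>, no edge lies inside
    \<open>P \<union> D\<close>, so vertices of \<open>D\<close> can only see
    \<open>Q\<close>.\<close>
  consider "v \<in> P" | "v \<in> Q" | "v \<in> D" using v by blast
  then have "E `` {v} \<inter> (P \<union> Q \<union> D) \<subseteq> D \<or> E `` {v} \<inter> (P \<union> Q \<union> D) \<subseteq> Q"
  proof cases
    assume "v \<in> P"
    then have "E `` {v} \<inter> (P \<union> Q \<union> D) \<subseteq> D" using P(1) Q(1) AA by blast
    then show ?thesis ..
  next
    assume "v \<in> Q"
    then have "E `` {v} \<inter> (P \<union> Q \<union> D) \<subseteq> D" using P(1) Q(1) AA by blast
    then show ?thesis ..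
  next
    assume "v \<in> D"
    then have "E `` {v} \<inter> (P \<union> Q \<union> D) \<subseteq> Q" using DD PD by blast
    then show ?thesis ..
  qed
  then have "card (E `` {v} \<inter> (P \<union> Q \<union> D)) \<le> 2"
    using card_mono fin D(2) Q(2) by metis
  with v show False by simp
qed

section \<open>Sparseness and triangle-freeness in terms of the edge relation\<close>

lemma out_degree_induce_subgraph:
  assumes "v \<in> S"
  shows "out_degree (with_proj G \<restriction> S) v = card (parcs G `` {v} \<inter> S)"
proof -
  have "out_arcs (with_proj G \<restriction> S) v = Pair v ` (parcs G `` {v} \<inter> S)"
    using assms by (auto simp: out_arcs_def induce_subgraph_def)
  then show ?thesis by (simp add: out_degree_def card_image inj_on_def)
qed

lemma sparse_set_with_proj:
  "sparse_set k (with_proj G) S \<longleftrightarrow>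
     S \<subseteq> pverts G \<and> (\<forall>v\<in>S. card (parcs G `` {v} \<inter> S) \<le> k)"
  by (auto simp: sparse_set_def out_degree_induce_subgraph)

text \<open>Degrees can only drop in a subset. This trims a large side of the cut to exactly 7
  vertices.\<close>

lemma sparse_set_subset:
  assumes "sparse_set k (with_proj G) T" "S \<subseteq> T" "finite T"
  shows "sparse_set k (with_proj G) S"
  unfolding sparse_set_with_proj
proof (intro conjI ballI)
  show "S \<subseteq> pverts G" using assms by (auto simp: sparse_set_with_proj)
  fix v assume "v \<in> S"
  have "card (parcs G `` {v} \<inter> S) \<le> card (parcs G `` {v} \<inter> T)"
    using assms by (intro card_mono) auto
  also have "\<dots> \<le> k" using assms \<open>v \<in> S\<close> by (auto simp: sparse_set_with_proj)
  finally show "card (parcs G `` {v} \<inter> S) \<le> k" .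
qed

lemma (in pair_graph) sym_parcs: "sym (parcs G)"
  using pair_sym_arcs by (simp add: symmetric_def)

lemma (in pair_graph) irrefl_parcs: "irrefl (parcs G)"
  using pair_no_loops by (force simp: irrefl_def)

lemma triangle_free_with_proj:
  "triangle_free (with_proj G) \<longleftrightarrow>
     \<not> (\<exists>u v w. (u, v) \<in> parcs G \<and> (v, w) \<in> parcs G \<and> (w, u) \<in> parcs G)"
  by (simp add: triangle_free_def)

section \<open>The upper bound\<close>

lemma triangle_free_13_sparse_7:
  fixes G :: "'a pair_pre_digraph"
  assumes "pair_graph G" "triangle_free (with_proj G)" "card (pverts G) = 13"
  shows "\<exists>S. sparse_set 2 (with_proj G) S \<and> card S = 7"
proof -
  let ?V = "pverts G" and ?E = "parcs G"
  have sym: "sym ?E" and irrefl: "irrefl ?E"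
    using assms(1) by (simp_all add: pair_graph.sym_parcs pair_graph.irrefl_parcs)
  have finite_verts: "finite ?V"
    using assms(3) by (intro card_ge_0_finite) simp
  have nbrs: "(x, y) \<notin> ?E" if "(v, x) \<in> ?E" "(v, y) \<in> ?E" for v x y
  proof
    assume "(x, y) \<in> ?E"
    with that(1) symD[OF sym that(2)] assms(2) show False
      unfolding triangle_free_with_proj by blast
  qed
  show ?thesis
  \<comment> \<open>Six neighbours of one vertex form an independent 6-set. If all degrees are at
    most 5, half the degree rounds down to 2, the bound required on each side of the cut.\<close>
  proof (cases "\<exists>v. card (?E `` {v} \<inter> ?V) \<ge> 6")
    case True
    then obtain v where "card (?E `` {v} \<inter> ?V) \<ge> 6" ..
    then obtain A where A: "A \<subseteq> ?E `` {v} \<inter> ?V" "card A = 6"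
      by (rule obtain_subset_with_card_n)
    have "\<exists>S\<subseteq>?V. card S = 7 \<and> (\<forall>v\<in>S. card (?E `` {v} \<inter> S) \<le> 2)"
    proof (rule sparse_seven_subset_of_independent_six[OF finite_verts assms(3) irrefl])
      show "(x, y) \<notin> ?E" if "(v, x) \<in> ?E" "(v, y) \<in> ?E" for v x y
        using that by (rule nbrs)
      show "A \<subseteq> ?V" using A(1) by simp
      have "(x, y) \<notin> ?E" if "x \<in> A" "y \<in> A" for x y
        using A(1) that by (intro nbrs[of v]) auto
      then show "?E \<inter> A \<times> A = {}" by auto
    qed (fact A(2))
    then show ?thesis unfolding sparse_set_with_proj by blast
  next
    case False
    then have deg: "card (?E `` {v} \<inter> ?V) \<le> 5" for v
    proof -
      have "\<not> card (?E `` {v} \<inter> ?V) \<ge> 6" using False by blast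
      then show ?thesis by linarith
    qed
    obtain X where X: "X \<subseteq> ?V"
        "\<And>v. v \<in> X \<Longrightarrow> 2 * card (?E `` {v} \<inter> X) \<le> card (?E `` {v} \<inter> ?V)"
        "\<And>v. v \<in> ?V - X \<Longrightarrow> 2 * card (?E `` {v} \<inter> (?V - X)) \<le> card (?E `` {v} \<inter> ?V)"
      using max_cut_half_degree[OF finite_verts sym irrefl] by blast
    have fX: "finite X" using X(1) finite_verts by (rule finite_subset)
    have "card (?E `` {v} \<inter> X) \<le> 2" if "v \<in> X" for v
      using X(2)[OF that] deg[of v] by linarith
    moreover have "card (?E `` {v} \<inter> (?V - X)) \<le> 2" if "v \<in> ?V - X" for v
      using X(3)[OF that] deg[of v] by linarith
    ultimately have "sparse_set 2 (with_proj G) X" "sparse_set 2 (with_proj G) (?V - X)"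
      using X(1) unfolding sparse_set_with_proj by blast+
    moreover have "card X + card (?V - X) = 13"
      using X(1) assms(3) fX card_mono[OF finite_verts X(1)] by (simp add: card_Diff_subset)
    then have "card X \<ge> 7 \<or> card (?V - X) \<ge> 7" by linarith
    ultimately obtain T where T: "sparse_set 2 (with_proj G) T" "finite T" "card T \<ge> 7"
      using fX finite_Diff[OF finite_verts] by blast
    from T(3) obtain S where "S \<subseteq> T" "card S = 7" by (rule obtain_subset_with_card_n)
    with T sparse_set_subset[of 2 G T S] show ?thesis by blast
  qed
qed

section \<open>The lower bound\<close>

definition parity_graph :: "nat \<Rightarrow> nat pair_pre_digraph" where
  "parity_graph n =
     \<lparr>pverts = {..<n}, parcs = {(u, v). u < n \<and> v < n \<and> even u \<noteq> even v}\<rparr>"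

lemma pair_graph_parity_graph: "pair_graph (parity_graph n)"
proof
  show "finite (parcs (parity_graph n))"
    by (rule finite_subset[of _ "{..<n} \<times> {..<n}"]) (auto simp: parity_graph_def)
qed (auto simp: parity_graph_def symmetric_def intro: symI)

lemma card_pverts_parity_graph: "card (pverts (parity_graph n)) = n"
  by (simp add: parity_graph_def)

lemma triangle_free_parity_graph: "triangle_free (with_proj (parity_graph n))"
  by (auto simp: triangle_free_def parity_graph_def)

lemma no_sparse_7_parity_graph:
  assumes "n \<le> 12" "sparse_set 2 (with_proj (parity_graph n)) S"
  shows "card S \<noteq> 7"
proof
  assume S7: "card S = 7"
  have S: "S \<subseteq> {..<n}"
    and deg: "\<And>v. v \<in> S \<Longrightarrow> card (parcs (parity_graph n) `` {v} \<inter> S) \<le> 2"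
    using assms(2) by (auto simp: sparse_set_with_proj parity_graph_def)
  have fS: "finite S" using S finite_subset by blast
  define P where "P c = {u \<in> S. even u = c}" for c
  have "P c \<subseteq> (\<lambda>i. 2 * i + of_bool (\<not> c)) ` {..<6}" for c
  proof
    fix u assume "u \<in> P c"
    then have "u < 12" "even u = c" using S assms(1) by (auto simp: P_def)
    then show "u \<in> (\<lambda>i. 2 * i + of_bool (\<not> c)) ` {..<6}"
      by (intro image_eqI[of _ _ "u div 2"]) (auto simp: odd_iff_mod_2_eq_one elim!: evenE oddE)
  qed
  then have le6: "card (P c) \<le> 6" for c
    using surj_card_le[of "{..<6::nat}"] by (metis card_lessThan finite_lessThan)
  have sum: "card (P c) + card (P (\<not> c)) = 7" for c
    unfolding S7[symmetric] P_def using fS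
    by (subst card_Un_disjoint[symmetric]) (auto intro: arg_cong[where f = card])
  \<comment> \<open>One parity class contains at least 4 of the 7 vertices, but at most 6, so the
    other class is also met; a vertex there is adjacent to all of the first class and has degree at
    least 4.\<close>
  have "card (P True) \<ge> 4 \<or> card (P (\<not> True)) \<ge> 4"
    using sum[of True] by linarith
  then obtain c where c: "card (P c) \<ge> 4" by blast
  have "P (\<not> c) \<noteq> {}" using sum[of c] le6[of c] by auto
  then obtain v where v: "v \<in> P (\<not> c)" by blast
  then have "parcs (parity_graph n) `` {v} \<inter> S = P c"
    using S by (auto simp: P_def parity_graph_def)
  with deg[of v] v c show False by (auto simp: P_def)
qed

theorem theorem3p6:
  shows "T_sparse 2 7 = 13 \<and>
    (\<forall>G :: 'a pair_pre_digraph.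
       pair_graph G \<and> triangle_free (with_proj G) \<and> card (pverts G) = 13 \<longrightarrow>
       (\<exists>S. sparse_set 2 (with_proj G) S \<and> card S = 7)) \<and>
    (\<exists>G :: nat pair_pre_digraph.
       pair_graph G \<and> triangle_free (with_proj G) \<and> card (pverts G) = 12 \<and>
       \<not> (\<exists>S. sparse_set 2 (with_proj G) S \<and> card S = 7))"
proof (intro conjI)
  \<comment> \<open>Counterexamples of every order up to 12, not just 12, exclude all smaller values
    of the minimum without any monotonicity argument in \<open>n\<close>.\<close>
  have small: "pair_graph (parity_graph n) \<and> triangle_free (with_proj (parity_graph n)) \<and>
      card (pverts (parity_graph n)) = n \<and>
      \<not> (\<exists>S. sparse_set 2 (with_proj (parity_graph n)) S \<and> card S = 7)" if "n \<le> 12" for n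
    using that pair_graph_parity_graph triangle_free_parity_graph no_sparse_7_parity_graph
      card_pverts_parity_graph by blast
  show "T_sparse 2 7 = 13"
    unfolding T_sparse_def
  proof (rule Least_equality)
    fix n
    assume n: "\<forall>G :: nat pair_pre_digraph.
      pair_graph G \<and> triangle_free (with_proj G) \<and> card (pverts G) = n \<longrightarrow>
      (\<exists>S. sparse_set 2 (with_proj G) S \<and> card S = 7)"
    have "\<not> n \<le> 12" using n small by blast
    then show "13 \<le> n" by simp
  qed (use triangle_free_13_sparse_7 in blast)
  show "\<exists>G :: nat pair_pre_digraph.
       pair_graph G \<and> triangle_free (with_proj G) \<and> card (pverts G) = 12 \<and>
       \<not> (\<exists>S. sparse_set 2 (with_proj G) S \<and> card S = 7)"
    using small[of 12] by blast
qed (use triangle_free_13_sparse_7 in blast)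

end
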